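(* Let $L=Fx+H$ be a finite dimensional Lie algebra over an algebraically closed field $F$ of characteristic $p>0$, where $x\in L$ and $H$ is an ideal in $L$. Let $\lambda:H\to F$ be a linear form. If $[L,L]$ is nilpotent, then $U(H)_\lambda$ is $\mathrm{ad}x$ stable and consequently is $\mathrm{ad}L$ stable.
   Context: $U(H)$ is the enveloping algebra of $H$, regarded as a subalgebra of the enveloping algebra $U(L)$ of $L$. For a linear form $\lambda:H\to F$, $U(H)_\lambda=\{u\in U(H) : [h,u]=\lambda(h)u \text{ for all } h\in H\}$. A subspace $W\subseteq U(H)$ is called $\mathrm{ad}x$ stable if $[x,W]\subseteq W$, and $\mathrm{ad}L$ stable if $[L,W]\subseteq W$, where brackets are commutators in $U(L)$. *)

theory Defs
  imports
    "HOL-Computational_Algebra.Computational_Algebra"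
    "HOL-Library.Poly_Mapping"
    "HOL-Algebra.QuotRing"
begin

section \<open>Free associative algebras\<close>

text \<open>
  A separate copy of the type of lists, so that concatenation can be made the addition required by
  the convolution product on \<^typ>\<open>'a \<Rightarrow>\<^sub>0 'b\<close> without adding class instances to lists.
\<close>

datatype 'a free_monoid = Word (letters: "'a list")

instantiation free_monoid :: (type) monoid_add
begin

definition zero_free_monoid :: "'a free_monoid"
  where "0 = Word []"

definition plus_free_monoid :: "'a free_monoid \<Rightarrow> 'a free_monoid \<Rightarrow> 'a free_monoid"
  where "v + w = Word (letters v @ letters w)"

instance
  by standard (simp_all add: zero_free_monoid_def plus_free_monoid_def)

end

definition free_algebra :: "'l set \<Rightarrow> ('l free_monoid \<Rightarrow>\<^sub>0 'f::comm_ring_1) ring"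
  where "free_algebra A =
    \<lparr>carrier = {a. \<forall>w \<in> Poly_Mapping.keys a. set (letters w) \<subseteq> A},
     monoid.mult = (*), one = 1, ring.zero = 0, add = (+)\<rparr>"

definition free_gen :: "'l \<Rightarrow> 'l free_monoid \<Rightarrow>\<^sub>0 'f::comm_ring_1"
  where "free_gen a = Poly_Mapping.single (Word [a]) 1"

definition free_const :: "'f \<Rightarrow> 'l free_monoid \<Rightarrow>\<^sub>0 'f::comm_ring_1"
  where "free_const c = Poly_Mapping.single 0 c"

definition ring_commutator :: "('a, 'm) ring_scheme \<Rightarrow> 'a \<Rightarrow> 'a \<Rightarrow> 'a"
  where "ring_commutator R a b = a \<otimes>\<^bsub>R\<^esub> b \<ominus>\<^bsub>R\<^esub> b \<otimes>\<^bsub>R\<^esub> a"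


section \<open>Lie algebras\<close>

context vector_space
begin

text \<open>Only the values of \<open>\<phi>\<close> on the subspace \<open>V\<close> matter.\<close>

definition linear_form_on :: "'b set \<Rightarrow> ('b \<Rightarrow> 'a) \<Rightarrow> bool"
  where "linear_form_on V \<phi> \<longleftrightarrow>
    (\<forall>u \<in> V. \<forall>v \<in> V. \<phi> (u + v) = \<phi> u + \<phi> v) \<and> (\<forall>c. \<forall>v \<in> V. \<phi> (c *s v) = c * \<phi> v)"

end

text \<open>
  The Lie algebra is the whole type \<^typ>\<open>'b\<close>; its subalgebras and ideals are sets. The bracket
  is required to be alternating, not merely antisymmetric, as is needed in characteristic 2.
\<close>

locale lie_algebra = vector_space scale
  for scale :: "'a::field \<Rightarrow> 'b::ab_group_add \<Rightarrow> 'b" (infixr \<open>*s\<close> 75) +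
  fixes bracket :: "'b \<Rightarrow> 'b \<Rightarrow> 'b"
  assumes bracket_add_left: "bracket (a + b) c = bracket a c + bracket b c"
    and bracket_add_right: "bracket a (b + c) = bracket a b + bracket a c"
    and bracket_scale_left: "bracket (r *s a) b = r *s bracket a b"
    and bracket_scale_right: "bracket a (r *s b) = r *s bracket a b"
    and bracket_self: "bracket a a = 0"
    and jacobi: "bracket a (bracket b c) + bracket b (bracket c a) + bracket c (bracket a b) = 0"
begin

definition lie_ideal :: "'b set \<Rightarrow> bool"
  where "lie_ideal H \<longleftrightarrow> subspace H \<and> (\<forall>a. \<forall>h \<in> H. bracket a h \<in> H)"

definition bracket_span :: "'b set \<Rightarrow> 'b set \<Rightarrow> 'b set"
  where "bracket_span A B = span {bracket a b | a b. a \<in> A \<and> b \<in> B}"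

primrec lower_central_series :: "'b set \<Rightarrow> nat \<Rightarrow> 'b set"
  where
    "lower_central_series A 0 = A"
  | "lower_central_series A (Suc n) = bracket_span A (lower_central_series A n)"

definition lie_nilpotent :: "'b set \<Rightarrow> bool"
  where "lie_nilpotent A \<longleftrightarrow> (\<exists>n. lower_central_series A n = {0})"


section \<open>Enveloping algebras\<close>

text \<open>
  The enveloping algebra of a Lie subalgebra \<open>A\<close> is the free associative unital algebra on the
  elements of \<open>A\<close> modulo the two-sided ideal generated by the following elements. The first two
  families impose linearity of \<open>A \<rightarrow> U(A)\<close> (they turn the free algebra on the set \<open>A\<close> into the
  tensor algebra of the vector space \<open>A\<close>), the third one compatibility with the bracket.
\<close>

definition env_relators :: "'b set \<Rightarrow> ('b free_monoid \<Rightarrow>\<^sub>0 'a) set"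
  where "env_relators A =
    {free_gen (a + b) - free_gen a - free_gen b | a b. a \<in> A \<and> b \<in> A} \<union>
    {free_gen (c *s a) - free_const c * free_gen a | c a. a \<in> A} \<union>
    {free_gen a * free_gen b - free_gen b * free_gen a - free_gen (bracket a b) | a b.
       a \<in> A \<and> b \<in> A}"

definition env_ideal :: "'b set \<Rightarrow> ('b free_monoid \<Rightarrow>\<^sub>0 'a) set"
  where "env_ideal A = Idl\<^bsub>free_algebra A\<^esub> (env_relators A)"

definition env :: "'b set \<Rightarrow> ('b free_monoid \<Rightarrow>\<^sub>0 'a) set ring"
  where "env A = free_algebra A Quot env_ideal A"

text \<open>From here on \<open>L\<close> denotes \<^term>\<open>UNIV :: 'b set\<close>.\<close>

abbreviation UL :: "('b free_monoid \<Rightarrow>\<^sub>0 'a) set ring"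
  where "UL \<equiv> env UNIV"

definition env_inj :: "'b \<Rightarrow> ('b free_monoid \<Rightarrow>\<^sub>0 'a) set"
  where "env_inj a = env_ideal UNIV +>\<^bsub>free_algebra UNIV\<^esub> free_gen a"

definition env_scale ::
  "'a \<Rightarrow> ('b free_monoid \<Rightarrow>\<^sub>0 'a) set \<Rightarrow> ('b free_monoid \<Rightarrow>\<^sub>0 'a) set"
  where "env_scale c u = (env_ideal UNIV +>\<^bsub>free_algebra UNIV\<^esub> free_const c) \<otimes>\<^bsub>UL\<^esub> u"

text \<open>
  The canonical homomorphism \<open>U(H) \<rightarrow> U(L)\<close> takes the coset of \<open>a\<close> modulo \<^term>\<open>env_ideal H\<close> to the
  coset of \<open>a\<close> modulo \<^term>\<open>env_ideal UNIV\<close>, i.e. it adds \<^term>\<open>env_ideal UNIV\<close> to the coset. By the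
  Poincare-Birkhoff-Witt theorem it is injective, and \<open>U(H)\<close> is identified with its image.
\<close>

definition env_embed ::
  "('b free_monoid \<Rightarrow>\<^sub>0 'a) set \<Rightarrow> ('b free_monoid \<Rightarrow>\<^sub>0 'a) set"
  where "env_embed u = env_ideal UNIV <+>\<^bsub>free_algebra UNIV\<^esub> u"

definition env_sub :: "'b set \<Rightarrow> ('b free_monoid \<Rightarrow>\<^sub>0 'a) set set"
  where "env_sub H = env_embed ` carrier (env H)"

definition env_weight_space :: "'b set \<Rightarrow> ('b \<Rightarrow> 'a) \<Rightarrow> ('b free_monoid \<Rightarrow>\<^sub>0 'a) set set"
  where "env_weight_space H \<phi> =
    {u \<in> env_sub H. \<forall>h \<in> H. ring_commutator UL (env_inj h) u = env_scale (\<phi> h) u}"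

definition ad_stable :: "'b set \<Rightarrow> ('b free_monoid \<Rightarrow>\<^sub>0 'a) set set \<Rightarrow> bool"
  where "ad_stable S W \<longleftrightarrow> (\<forall>s \<in> S. \<forall>w \<in> W. ring_commutator UL (env_inj s) w \<in> W)"

end

end

theory Submission
  imports Defs
begin

text \<open>
  Let \<open>u\<close> be a weight vector of weight \<open>\<phi>\<close>, let \<open>h \<in> H\<close>, and let \<open>y = [l, h]\<close> with \<open>l \<in> L\<close>.
  Since \<open>[L, L]\<close> is nilpotent and contains \<open>[y, L]\<close>, the map \<open>ad y\<close> is nilpotent on \<open>L\<close>; being a
  derivation, it is then locally nilpotent on \<open>U(L)\<close>. As \<open>u\<close> is an eigenvector of \<open>ad y\<close> for the
  eigenvalue \<open>\<phi> y\<close>, it follows that \<open>\<phi> y = 0\<close> or \<open>u = 0\<close>, so that \<open>\<phi> ([l, h]) u = 0\<close>. By the Jacobi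
  identity, \<open>[h, [l, u]] = [l, [h, u]] - [[l, h], u] = \<phi> h [l, u]\<close>.
  All computations take place in the free algebra modulo the ideal defining \<open>U(L)\<close>.
\<close>

section \<open>Inner derivations of associative rings\<close>

text \<open>Lives in a type-class ring, so that representatives in the free algebra can be handled
  by plain algebra; \<open>env_class_commutator\<close> carries the results over to
  \<open>UL\<close>.\<close>

definition commutator :: "'r::ring_1 \<Rightarrow> 'r \<Rightarrow> 'r"
  where "commutator a b = a * b - b * a"

lemma commutator_add_right: "commutator g (a + b) = commutator g a + commutator g b"
  by (simp add: commutator_def algebra_simps)

lemma commutator_diff_right: "commutator g (a - b) = commutator g a - commutator g b"
  by (simp add: commutator_def algebra_simps)

lemma commutator_mult_right:
  "commutator g (a * b) = commutator g a * b + a * commutator g b"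
  by (simp add: commutator_def algebra_simps)

lemma funpow_commutator_add:
  "(commutator g ^^ n) (a + b) = (commutator g ^^ n) a + (commutator g ^^ n) b"
  by (induction n) (simp_all add: commutator_add_right)

section \<open>Free algebras: scalars, ring structure and generators\<close>

lemma update_eq_add_single:
  assumes "w \<notin> Poly_Mapping.keys f"
  shows "Poly_Mapping.update w b f = f + Poly_Mapping.single w b"
  using assms
  by (intro poly_mapping_eqI)
    (auto simp: lookup_update lookup_add lookup_single when_def in_keys_iff)

text \<open>Scalars sit on the empty word, which is neutral for concatenation, and the coefficients
  commute. Hence inner derivations are linear over the scalars.\<close>

lemma free_const_mult_commute: "free_const c * a = a * free_const c"
proof (induction a rule: Poly_Mapping.update_induct)
  case (update f w b)
  then show ?case
    by (simp add: update_eq_add_single free_const_def distrib_left distrib_right mult_single mult.commute)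
qed simp

lemma commutator_free_const: "commutator g (free_const c) = 0"
  by (simp add: commutator_def free_const_mult_commute)

lemma commutator_free_const_mult: "commutator g (free_const c * a) = free_const c * commutator g a"
  by (simp add: commutator_mult_right commutator_free_const)

lemma free_const_mult: "free_const c * free_const d = free_const (c * d)"
  by (simp add: free_const_def mult_single)

lemma free_const_1: "free_const 1 = 1"
  by (simp add: free_const_def)

lemma free_algebra_simps [simp]:
  "a \<otimes>\<^bsub>free_algebra A\<^esub> b = a * b" "a \<oplus>\<^bsub>free_algebra A\<^esub> b = a + b"
  "\<one>\<^bsub>free_algebra A\<^esub> = 1" "\<zero>\<^bsub>free_algebra A\<^esub> = 0"
  by (simp_all add: free_algebra_def)

lemma carrier_free_algebra_UNIV [simp]: "carrier (free_algebra UNIV) = UNIV"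
  by (simp add: free_algebra_def)

lemma free_algebra_add_closed:
  "a \<in> carrier (free_algebra A) \<Longrightarrow> b \<in> carrier (free_algebra A) \<Longrightarrow> a + b \<in> carrier (free_algebra A)"
  using Poly_Mapping.keys_add[of a b] by (auto simp: free_algebra_def)

lemma free_algebra_mult_closed:
  "a \<in> carrier (free_algebra A) \<Longrightarrow> b \<in> carrier (free_algebra A) \<Longrightarrow> a * b \<in> carrier (free_algebra A)"
  using Poly_Mapping.keys_mult[of a b]
  by (fastforce simp: free_algebra_def plus_free_monoid_def)

lemma free_algebra_uminus_closed:
  "a \<in> carrier (free_algebra A) \<Longrightarrow> - a \<in> carrier (free_algebra A)"
  by (auto simp: free_algebra_def in_keys_iff)

lemma free_algebra_const_closed: "free_const c \<in> carrier (free_algebra A)"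
  by (simp add: free_algebra_def free_const_def zero_free_monoid_def)

lemma free_algebra_gen_closed: "h \<in> A \<Longrightarrow> free_gen h \<in> carrier (free_algebra A)"
  by (simp add: free_algebra_def free_gen_def)

lemma ring_free_algebra: "ring (free_algebra A)"
proof (rule ringI)
  show "abelian_group (free_algebra A)"
  proof (rule abelian_groupI)
    fix a assume "a \<in> carrier (free_algebra A)"
    then show "\<exists>b\<in>carrier (free_algebra A). b \<oplus>\<^bsub>free_algebra A\<^esub> a = \<zero>\<^bsub>free_algebra A\<^esub>"
      by (intro bexI[of _ "- a"]) (simp_all add: free_algebra_uminus_closed)
  qed (simp_all add: free_algebra_add_closed add_ac, simp add: free_algebra_def)
  show "Group.monoid (free_algebra A)"
    by (rule monoidI) (simp_all add: free_algebra_mult_closed mult.assoc, simp add: free_algebra_def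
        zero_free_monoid_def)
qed (simp_all add: algebra_simps)

lemma free_algebra_a_inv: "\<ominus>\<^bsub>free_algebra A\<^esub> a = - a" if "a \<in> carrier (free_algebra A)"
proof -
  interpret ring "free_algebra A" by (rule ring_free_algebra)
  show ?thesis
    using that minus_equality[of "- a" a] by (simp add: free_algebra_uminus_closed)
qed

lemma free_algebra_a_minus: "a \<ominus>\<^bsub>free_algebra UNIV\<^esub> b = a - b"
  by (simp add: a_minus_def free_algebra_a_inv)

text \<open>A polynomial is a sum of monomials, and a monomial is a product of letters and a scalar.
  This is suited to derivations, which are controlled by their values on generators.\<close>

lemma free_algebra_induct [consumes 1, case_names const gen add mult]:
  assumes "a \<in> carrier (free_algebra A)"
    and const: "\<And>c. P (free_const c)"
    and gen: "\<And>h. h \<in> A \<Longrightarrow> P (free_gen h)"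
    and add: "\<And>a b. P a \<Longrightarrow> P b \<Longrightarrow> P (a + b)"
    and mult: "\<And>a b. P a \<Longrightarrow> P b \<Longrightarrow> P (a * b)"
  shows "P a"
proof -
  have word: "P (Poly_Mapping.single (Word xs) c)" if "set xs \<subseteq> A" for xs c
    using that
  proof (induction xs)
    case Nil
    then show ?case
      using const[of c] by (simp add: free_const_def zero_free_monoid_def)
  next
    case (Cons h xs)
    \<comment> \<open>The coefficient stays with the tail until the empty word turns it into a
      \<open>free_const\<close>.\<close>
    have "Poly_Mapping.single (Word (h # xs)) c = free_gen h * Poly_Mapping.single (Word xs) c"
      by (simp add: free_gen_def mult_single plus_free_monoid_def)
    then show ?case
      using Cons by (simp add: mult gen)
  qed
  have "\<forall>w\<in>Poly_Mapping.keys a. set (letters w) \<subseteq> A"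
    using assms(1) by (simp add: free_algebra_def)
  then show ?thesis
  proof (induction a rule: Poly_Mapping.update_induct)
    case const
    then show ?case
      using assms(2)[of 0] by (simp add: free_const_def)
  next
    case (update f w b)
    have keys: "Poly_Mapping.keys (Poly_Mapping.update w b f) = insert w (Poly_Mapping.keys f)"
      using update.hyps by (auto simp: in_keys_iff lookup_update split: if_splits)
    have "P f"
      using update.prems keys by (intro update.IH) auto
    moreover have "P (Poly_Mapping.single w b)"
      using word[of "letters w" b] update.prems keys by simp
    ultimately show ?case
      unfolding update_eq_add_single[OF update.hyps(1)] by (rule add)
  qed
qed

section \<open>The defining ideal of U(L) and its cosets\<close>

context lie_algebra
begin

abbreviation env_class :: "('b free_monoid \<Rightarrow>\<^sub>0 'a) \<Rightarrow> ('b free_monoid \<Rightarrow>\<^sub>0 'a) set"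
  where "env_class a \<equiv> env_ideal UNIV +>\<^bsub>free_algebra UNIV\<^esub> a"

lemma ideal_env_ideal: "ideal (env_ideal UNIV) (free_algebra UNIV)"
  unfolding env_ideal_def by (rule ring.genideal_ideal[OF ring_free_algebra]) simp

lemma env_relators_subset: "env_relators UNIV \<subseteq> env_ideal UNIV"
  unfolding env_ideal_def by (rule ring.genideal_self[OF ring_free_algebra]) simp

lemma
  shows env_ideal_0: "0 \<in> env_ideal UNIV"
    and env_ideal_add: "a \<in> env_ideal UNIV \<Longrightarrow> b \<in> env_ideal UNIV \<Longrightarrow> a + b \<in> env_ideal UNIV"
    and env_ideal_uminus: "a \<in> env_ideal UNIV \<Longrightarrow> - a \<in> env_ideal UNIV"
    and env_ideal_mult_left: "a \<in> env_ideal UNIV \<Longrightarrow> r * a \<in> env_ideal UNIV"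
    and env_ideal_mult_right: "a \<in> env_ideal UNIV \<Longrightarrow> a * r \<in> env_ideal UNIV"
proof -
  interpret ideal "env_ideal UNIV" "free_algebra UNIV" by (rule ideal_env_ideal)
  show "0 \<in> env_ideal UNIV"
    using additive_subgroup.zero_closed[OF ideal.axioms(1)[OF ideal_env_ideal]] by simp
  show "a + b \<in> env_ideal UNIV" if "a \<in> env_ideal UNIV" "b \<in> env_ideal UNIV"
    using additive_subgroup.a_closed[OF ideal.axioms(1)[OF ideal_env_ideal] that] by simp
  show "- a \<in> env_ideal UNIV" if "a \<in> env_ideal UNIV"
    using additive_subgroup.a_inv_closed[OF ideal.axioms(1)[OF ideal_env_ideal] that] by (simp add: free_algebra_a_inv)
  show "r * a \<in> env_ideal UNIV" if "a \<in> env_ideal UNIV"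
    using I_l_closed[OF that, of r] by simp
  show "a * r \<in> env_ideal UNIV" if "a \<in> env_ideal UNIV"
    using I_r_closed[OF that, of r] by simp
qed

lemma env_ideal_diff: "a \<in> env_ideal UNIV \<Longrightarrow> b \<in> env_ideal UNIV \<Longrightarrow> a - b \<in> env_ideal UNIV"
  using env_ideal_add[OF _ env_ideal_uminus, of a b] by simp

lemma env_ideal_commutator: "a \<in> env_ideal UNIV \<Longrightarrow> commutator g a \<in> env_ideal UNIV"
  by (simp add: commutator_def env_ideal_diff env_ideal_mult_left env_ideal_mult_right)

lemma env_ideal_commutator_left: "a \<in> env_ideal UNIV \<Longrightarrow> commutator a g \<in> env_ideal UNIV"
  by (simp add: commutator_def env_ideal_diff env_ideal_mult_left env_ideal_mult_right)

lemma env_ideal_funpow_commutator: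
  "a \<in> env_ideal UNIV \<Longrightarrow> (commutator g ^^ n) a \<in> env_ideal UNIV"
  by (induction n) (simp_all add: env_ideal_commutator)

lemma free_gen_commutator:
  "commutator (free_gen a) (free_gen b) - free_gen (bracket a b) \<in> env_ideal UNIV"
  using env_relators_subset unfolding env_relators_def commutator_def by blast

text \<open>In the free algebra \<open>free_gen 0\<close> is a nonzero letter; the additivity
  relator for 0 + 0 is its negative.\<close>

lemma free_gen_0: "free_gen 0 \<in> env_ideal UNIV"
proof -
  have "free_gen (0 + 0) - free_gen 0 - free_gen 0 \<in> env_relators UNIV"
    unfolding env_relators_def by (intro UnI1 CollectI exI[of _ 0]) simp
  then have "- free_gen 0 \<in> env_ideal UNIV"
    using env_relators_subset by auto
  then show ?thesis
    using env_ideal_uminus[of "- free_gen 0"] by simp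
qed

lemma env_class_eq_iff: "env_class a = env_class b \<longleftrightarrow> a - b \<in> env_ideal UNIV"
  using ring.quotient_eq_iff_same_a_r_cos[OF ring_free_algebra ideal_env_ideal, of a b]
  by (simp add: free_algebra_a_minus)

lemma env_class_mult: "env_class a \<otimes>\<^bsub>UL\<^esub> env_class b = env_class (a * b)"
  using ring_hom_mult[OF ideal.rcos_ring_hom[OF ideal_env_ideal], of a b] by (simp add: env_def)

lemma env_class_commutator:
  "ring_commutator UL (env_class a) (env_class b) = env_class (commutator a b)"
proof -
  interpret ring_hom_ring "free_algebra UNIV" UL env_class
    unfolding env_def by (rule ideal.rcos_ring_hom_ring[OF ideal_env_ideal])
  have "env_class (c - d) = env_class c \<ominus>\<^bsub>UL\<^esub> env_class d" for c d
    using hom_add[of c "- d"] hom_a_inv[of d] by (simp add: a_minus_def free_algebra_a_inv)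
  then show ?thesis
    by (simp add: ring_commutator_def commutator_def env_class_mult)
qed

section \<open>U(H) and its weight spaces in terms of representatives\<close>

text \<open>The ideal of U(L), cut down to polynomials in letters of \<open>H\<close>, is an ideal
  there and contains the relators of \<open>H\<close>, so minimality of the generated ideal
  applies.\<close>

lemma env_ideal_mono:
  assumes "lie_ideal H"
  shows "env_ideal H \<subseteq> env_ideal UNIV"
proof -
  let ?F = "free_algebra H :: ('b free_monoid \<Rightarrow>\<^sub>0 'a) ring"
  let ?K = "env_ideal UNIV \<inter> carrier ?F"
  interpret F: ring ?F by (rule ring_free_algebra)
  have H: "subspace H" "\<And>a h. h \<in> H \<Longrightarrow> bracket a h \<in> H"
    using assms by (auto simp: lie_ideal_def)
  have diff: "a - b \<in> carrier ?F" if "a \<in> carrier ?F" "b \<in> carrier ?F" for a b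
    using free_algebra_add_closed[OF that(1) free_algebra_uminus_closed[OF that(2)]] by simp
  have "ideal ?K ?F"
  proof (rule idealI)
    show "subgroup ?K (add_monoid ?F)"
      by (rule F.add.subgroupI)
        (auto simp: env_ideal_add env_ideal_uminus free_algebra_add_closed
          free_algebra_uminus_closed free_algebra_a_inv simp flip: a_inv_def
          intro: env_ideal_0 F.zero_closed[simplified])
  qed (simp_all add: ring_free_algebra env_ideal_mult_left env_ideal_mult_right
        free_algebra_mult_closed)
  moreover have "env_relators H \<subseteq> ?K"
  proof
    fix r assume r: "r \<in> env_relators H"
    then have "r \<in> env_relators UNIV"
      unfolding env_relators_def by blast
    moreover have "r \<in> carrier ?F"
      using r H unfolding env_relators_def
      by (auto intro!: diff free_algebra_mult_closed free_algebra_gen_closed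
          free_algebra_const_closed simp: subspace_add subspace_scale)
    ultimately show "r \<in> ?K"
      using env_relators_subset by blast
  qed
  ultimately show ?thesis
    using F.genideal_minimal[of ?K] by (auto simp: env_ideal_def)
qed

text \<open>By \<open>env_ideal_mono\<close> the sum of the two ideals collapses to
  \<open>env_ideal UNIV\<close>.\<close>

lemma env_embed_coset:
  assumes "lie_ideal H"
  shows "env_embed (env_ideal H +>\<^bsub>free_algebra H\<^esub> a) = env_class a"
proof -
  have 0: "0 \<in> env_ideal H"
    unfolding env_ideal_def genideal_def
    using additive_subgroup.zero_closed[OF ideal.axioms(1), of _ "free_algebra H"] by auto
  have "(\<exists>i\<in>env_ideal UNIV. \<exists>j\<in>env_ideal H. u = i + (j + a)) \<longleftrightarrow>
      (\<exists>i\<in>env_ideal UNIV. u = i + a)" for u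
  proof
    assume "\<exists>i\<in>env_ideal UNIV. \<exists>j\<in>env_ideal H. u = i + (j + a)"
    then obtain i j where "i \<in> env_ideal UNIV" "j \<in> env_ideal UNIV" "u = (i + j) + a"
      using env_ideal_mono[OF assms] by (auto simp: add.assoc)
    then show "\<exists>i\<in>env_ideal UNIV. u = i + a"
      by (blast intro: env_ideal_add)
  next
    assume "\<exists>i\<in>env_ideal UNIV. u = i + a"
    with 0 show "\<exists>i\<in>env_ideal UNIV. \<exists>j\<in>env_ideal H. u = i + (j + a)"
      by force
  qed
  then show ?thesis
    by (simp add: set_eq_iff env_embed_def set_add_def set_mult_def a_r_coset_def r_coset_def)
qed

lemma env_sub_eq:
  assumes "lie_ideal H"
  shows "env_sub H = env_class ` carrier (free_algebra H)"
proof -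
  have "carrier (env H) = (\<lambda>a. env_ideal H +>\<^bsub>free_algebra H\<^esub> a) ` carrier (free_algebra H)"
    by (auto simp: env_def FactRing_def A_RCOSETS_def RCOSETS_def a_r_coset_def)
  then show ?thesis
    by (simp add: env_sub_def image_image env_embed_coset[OF assms])
qed

lemma env_weight_space_eq:
  assumes "lie_ideal H"
  shows "env_weight_space H \<phi> = env_class ` {a \<in> carrier (free_algebra H).
    \<forall>h\<in>H. commutator (free_gen h) a - free_const (\<phi> h) * a \<in> env_ideal UNIV}"
proof -
  have "(\<forall>h\<in>H. ring_commutator UL (env_inj h) (env_class a) = env_scale (\<phi> h) (env_class a)) \<longleftrightarrow>
      (\<forall>h\<in>H. commutator (free_gen h) a - free_const (\<phi> h) * a \<in> env_ideal UNIV)" for a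
    by (simp add: env_inj_def env_scale_def env_class_commutator env_class_mult env_class_eq_iff)
  then show ?thesis
    unfolding env_weight_space_def env_sub_eq[OF assms] by blast
qed

text \<open>U(H) is stable under ad l: a generator h goes to [l,h], which lies in the ideal
  \<open>H\<close>, and the Leibniz rule handles products. The commutator itself contains the letter
  \<open>l\<close>, so \<open>b\<close> exists only modulo \<open>env_ideal UNIV\<close>.\<close>

lemma commutator_free_algebra:
  assumes "lie_ideal H" and "a \<in> carrier (free_algebra H)"
  shows "\<exists>b\<in>carrier (free_algebra H). commutator (free_gen l) a - b \<in> env_ideal UNIV"
proof -
  \<comment> \<open>Membership of \<open>a\<close> is carried along because the Leibniz rule in the
    product case also involves the undifferentiated factors.\<close>
  have "a \<in> carrier (free_algebra H) \<and>
    (\<exists>b\<in>carrier (free_algebra H). commutator (free_gen l) a - b \<in> env_ideal UNIV)"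
    using assms(2)
  proof (induction a rule: free_algebra_induct)
    case (const c)
    show ?case
      using free_algebra_const_closed[of c H] free_algebra_const_closed[of 0 H]
      by (auto simp: commutator_free_const free_const_def[of 0] env_ideal_0 intro!: bexI[of _ 0])
  next
    case (gen h)
    then show ?case
      using assms(1) free_gen_commutator[of l h]
      by (auto simp: lie_ideal_def intro: free_algebra_gen_closed)
  next
    case (add a b)
    then obtain a' b' where
      "a' \<in> carrier (free_algebra H)" "commutator (free_gen l) a - a' \<in> env_ideal UNIV"
      "b' \<in> carrier (free_algebra H)" "commutator (free_gen l) b - b' \<in> env_ideal UNIV"
      by blast
    then show ?case
      using add env_ideal_add[of "commutator (free_gen l) a - a'" "commutator (free_gen l) b - b'"]
      by (auto simp: commutator_add_right free_algebra_add_closed algebra_simps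
          intro!: bexI[of _ "a' + b'"])
  next
    case (mult a b)
    then obtain a' b' where ab:
      "a' \<in> carrier (free_algebra H)" "commutator (free_gen l) a - a' \<in> env_ideal UNIV"
      "b' \<in> carrier (free_algebra H)" "commutator (free_gen l) b - b' \<in> env_ideal UNIV"
      by blast
    have "(commutator (free_gen l) a - a') * b + a * (commutator (free_gen l) b - b')
        \<in> env_ideal UNIV"
      using ab by (intro env_ideal_add env_ideal_mult_left env_ideal_mult_right)
    then have "commutator (free_gen l) (a * b) - (a' * b + a * b') \<in> env_ideal UNIV"
      by (simp add: commutator_mult_right algebra_simps)
    then show ?case
      using mult ab by (blast intro: free_algebra_add_closed free_algebra_mult_closed)
  qed
  then show ?thesis ..
qed

section \<open>Local nilpotence on U(L)\<close>

text \<open>Induction on the sum of the exponents replaces the binomial formula: one Leibniz step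
  lowers the exponent required for one factor. If an exponent is 0, that factor, and with it the
  product, is already in the ideal.\<close>

lemma funpow_commutator_mult:
  assumes "(commutator g ^^ m) a \<in> env_ideal UNIV" and "(commutator g ^^ n) b \<in> env_ideal UNIV"
  shows "(commutator g ^^ (m + n)) (a * b) \<in> env_ideal UNIV"
  using assms
proof (induction "m + n" arbitrary: m n a b)
  case 0
  then show ?case
    by (simp add: env_ideal_mult_right)
next
  case (Suc k)
  consider "m = 0" | "n = 0" | m' n' where "m = Suc m'" "n = Suc n'"
    by (metis not0_implies_Suc)
  then show ?case
  proof cases
    case 1
    with Suc.prems(1) show ?thesis
      by (simp add: env_ideal_funpow_commutator env_ideal_mult_right)
  next
    case 2
    with Suc.prems(2) show ?thesis
      by (simp add: env_ideal_funpow_commutator env_ideal_mult_left)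
  next
    case 3
    have "(commutator g ^^ (m' + n)) (commutator g a * b) \<in> env_ideal UNIV"
      using Suc 3(1) by (intro Suc.hyps(1)) (simp_all add: funpow_swap1)
    moreover have "(commutator g ^^ (m + n')) (a * commutator g b) \<in> env_ideal UNIV"
      using Suc 3(2) by (intro Suc.hyps(1)) (simp_all add: funpow_swap1)
    moreover have "(commutator g ^^ (m + n)) (a * b) =
        (commutator g ^^ (m' + n)) (commutator g a * b) +
        (commutator g ^^ (m + n')) (a * commutator g b)"
      by (simp add: 3 funpow_swap1 commutator_mult_right funpow_commutator_add commutator_add_right)
    ultimately show ?thesis
      by (simp add: env_ideal_add)
  qed
qed

lemma funpow_commutator_free_gen:
  "(commutator (free_gen y) ^^ n) (free_gen z) - free_gen ((bracket y ^^ n) z) \<in> env_ideal UNIV"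
proof (induction n)
  case 0
  then show ?case
    by (simp add: env_ideal_0)
next
  case (Suc n)
  have "commutator (free_gen y)
      ((commutator (free_gen y) ^^ n) (free_gen z) - free_gen ((bracket y ^^ n) z)) +
    (commutator (free_gen y) (free_gen ((bracket y ^^ n) z)) -
      free_gen (bracket y ((bracket y ^^ n) z))) \<in> env_ideal UNIV"
    using Suc by (intro env_ideal_add env_ideal_commutator free_gen_commutator)
  then show ?case
    by (simp add: commutator_diff_right)
qed

text \<open>The elements killed by some power of a derivation form a subalgebra, so it is enough
  that the generators are killed; the exponent may depend on the element.\<close>

lemma locally_nilpotent_commutator:
  assumes "\<And>z. \<exists>n. (bracket y ^^ n) z = 0"
  shows "\<exists>n. (commutator (free_gen y) ^^ n) a \<in> env_ideal UNIV"
proof -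
  have "a \<in> carrier (free_algebra UNIV)"
    by simp
  then show ?thesis
  proof (induction a rule: free_algebra_induct)
    case (const c)
    show ?case
      by (intro exI[of _ 1]) (simp add: commutator_free_const env_ideal_0)
  next
    case (gen z)
    obtain n where "(bracket y ^^ n) z = 0"
      using assms by blast
    then show ?case
      using env_ideal_add[OF funpow_commutator_free_gen[where y = y and n = n and z = z] free_gen_0] by auto
  next
    case (add a b)
    then obtain m n where "(commutator (free_gen y) ^^ m) a \<in> env_ideal UNIV"
      "(commutator (free_gen y) ^^ n) b \<in> env_ideal UNIV"
      by blast
    \<comment> \<open>Both exponents are raised to a common one.\<close>
    then have "(commutator (free_gen y) ^^ (n + m)) a \<in> env_ideal UNIV"
      "(commutator (free_gen y) ^^ (m + n)) b \<in> env_ideal UNIV"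
      by (simp_all add: funpow_add env_ideal_funpow_commutator)
    then show ?case
      by (metis add.commute env_ideal_add funpow_commutator_add)
  next
    case (mult a b)
    then show ?case
      using funpow_commutator_mult by blast
  qed
qed

text \<open>Since \<open>y\<close> is in [L,L], each further application of ad y descends one term
  of the lower central series of [L,L].\<close>

lemma lie_nilpotent_derived_funpow_bracket:
  assumes "lie_nilpotent (bracket_span UNIV UNIV)" and "y \<in> bracket_span UNIV UNIV"
  shows "\<exists>n. (bracket y ^^ n) z = 0"
proof -
  \<comment> \<open>\<open>z\<close> is arbitrary, so the first application is spent on reaching
    [L,L], the term of index 0.\<close>
  have "(bracket y ^^ Suc n) z \<in> lower_central_series (bracket_span UNIV UNIV) n" for n
  proof (induction n)
    case 0
    show ?case
      by (auto simp: bracket_span_def intro!: span_base)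
  next
    case (Suc n)
    then show ?case
      using assms(2) by (auto simp: bracket_span_def[of "bracket_span UNIV UNIV"] intro!: span_base)
  qed
  then show ?thesis
    using assms(1) unfolding lie_nilpotent_def by (metis singletonD)
qed

section \<open>Vanishing of weights on [L,H] and stability\<close>

text \<open>Modulo the ideal, the n-th power of the derivation multiplies \<open>a\<close> by
  \<open>c ^ n\<close>; if \<open>c\<close> is nonzero, this can be inverted to give a = 0. The
  product \<open>c\<close> times \<open>a\<close> covers the cases c = 0 and a = 0 at once.\<close>

lemma eigenvalue_free_const_mult:
  assumes "commutator g a - free_const c * a \<in> env_ideal UNIV"
    and "(commutator g ^^ n) a \<in> env_ideal UNIV"
  shows "free_const c * a \<in> env_ideal UNIV"
proof (cases "c = 0")
  case True
  then show ?thesis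
    by (simp add: free_const_def env_ideal_0)
next
  case False
  have "(commutator g ^^ k) a - free_const (c ^ k) * a \<in> env_ideal UNIV" for k
  proof (induction k)
    case 0
    show ?case
      by (simp add: free_const_1 env_ideal_0)
  next
    case (Suc k)
    have "commutator g ((commutator g ^^ k) a - free_const (c ^ k) * a) +
        free_const (c ^ k) * (commutator g a - free_const c * a) \<in> env_ideal UNIV"
      using Suc assms(1) by (intro env_ideal_add env_ideal_commutator env_ideal_mult_left)
    then show ?case
      by (simp add: commutator_diff_right commutator_free_const_mult right_diff_distrib
          free_const_mult mult.commute flip: mult.assoc)
  qed
  from env_ideal_diff[OF assms(2) this[of n]] have "free_const (c ^ n) * a \<in> env_ideal UNIV"
    by simp
  then have "free_const (inverse (c ^ n)) * (free_const (c ^ n) * a) \<in> env_ideal UNIV"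
    by (rule env_ideal_mult_left)
  then have "a \<in> env_ideal UNIV"
    using False by (simp add: free_const_mult free_const_1 flip: mult.assoc)
  then show ?thesis
    by (rule env_ideal_mult_left)
qed

lemma ad_stable_env_weight_space:
  assumes "lie_ideal H" and "lie_nilpotent (bracket_span UNIV UNIV)"
  shows "ad_stable UNIV (env_weight_space H \<phi>)"
  unfolding ad_stable_def env_weight_space_eq[OF assms(1)]
proof (intro ballI, elim imageE, clarify)
  fix l a
  let ?I = "env_ideal UNIV"
  assume a: "a \<in> carrier (free_algebra H)"
    and weight: "\<forall>h\<in>H. commutator (free_gen h) a - free_const (\<phi> h) * a \<in> ?I"
  \<comment> \<open>Membership in the weight space needs a representative of [l,a] in letters of
    \<open>H\<close>.\<close>
  obtain b where b: "b \<in> carrier (free_algebra H)" "commutator (free_gen l) a - b \<in> ?I"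
    using commutator_free_algebra[OF assms(1) a] by blast
  have "commutator (free_gen h) b - free_const (\<phi> h) * b \<in> ?I" if h: "h \<in> H" for h
  proof -
    let ?y = "bracket l h" and ?l = "free_gen l" and ?h = "free_gen h"
    \<comment> \<open>\<open>?y\<close> lies in \<open>H\<close>, so the weight relation applies to
      it, and in [L,L], so ad \<open>?y\<close> is locally nilpotent.\<close>
    have y: "?y \<in> H"
      using assms(1) h by (simp add: lie_ideal_def)
    have "?y \<in> bracket_span UNIV UNIV"
      unfolding bracket_span_def by (rule span_base) blast
    then obtain n where "(commutator (free_gen ?y) ^^ n) a \<in> ?I"
      using locally_nilpotent_commutator lie_nilpotent_derived_funpow_bracket[OF assms(2)] by blast
    with weight y have "free_const (\<phi> ?y) * a \<in> ?I"
      using eigenvalue_free_const_mult by blast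
    with weight y have "(commutator (free_gen ?y) a - free_const (\<phi> ?y) * a)
        + free_const (\<phi> ?y) * a \<in> ?I"
      by (blast intro: env_ideal_add)
    \<comment> \<open>The sum is [[l,h],a] in the free algebra, which the Jacobi identity rewrites
      as [l,[h,a]] - [h,[l,a]].\<close>
    then have "commutator (commutator ?l ?h - free_gen ?y) a + commutator (free_gen ?y) a \<in> ?I"
      by (simp add: env_ideal_add env_ideal_commutator_left free_gen_commutator)
    then have 1: "commutator ?l (commutator ?h a) - commutator ?h (commutator ?l a) \<in> ?I"
      by (simp add: commutator_def algebra_simps)
    have 2: "commutator ?l (commutator ?h a - free_const (\<phi> h) * a) \<in> ?I"
      using weight h by (intro env_ideal_commutator) blast
    \<comment> \<open>All terms containing \<open>a\<close> cancel, leaving exactly the weight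
      relation for \<open>b\<close>.\<close>
    have "commutator ?l (commutator ?h a - free_const (\<phi> h) * a)
        - (commutator ?l (commutator ?h a) - commutator ?h (commutator ?l a))
        - commutator ?h (commutator ?l a - b) + free_const (\<phi> h) * (commutator ?l a - b) \<in> ?I"
      by (rule env_ideal_add[OF env_ideal_diff[OF env_ideal_diff[OF 2 1] env_ideal_commutator[OF b(2)]]
            env_ideal_mult_left[OF b(2)]])
    then show ?thesis
      by (simp add: commutator_diff_right commutator_free_const_mult right_diff_distrib)
  qed
  moreover have "ring_commutator UL (env_inj l) (env_class a) = env_class b"
    using b(2) by (simp add: env_inj_def env_class_commutator env_class_eq_iff)
  ultimately show "ring_commutator UL (env_inj l) (env_class a) \<in> env_class `
      {a \<in> carrier (free_algebra H).
        \<forall>h\<in>H. commutator (free_gen h) a - free_const (\<phi> h) * a \<in> env_ideal UNIV}"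
    using b(1) by blast
qed

end

theorem lemma2p4:
  fixes scale :: "'f::alg_closed_field \<Rightarrow> 'l::ab_group_add \<Rightarrow> 'l"
    and bracket :: "'l \<Rightarrow> 'l \<Rightarrow> 'l"
    and x :: 'l and H :: "'l set" and \<phi> :: "'l \<Rightarrow> 'f" and p :: nat
  assumes "lie_algebra scale bracket"
    and "\<exists>B. finite_dimensional_vector_space scale B"
    and "CHAR('f) = p" and "p > 0"
    and "lie_algebra.lie_ideal scale bracket H"
    and "UNIV = {scale c x + h | c h. h \<in> H}"
    and "vector_space.linear_form_on scale H \<phi>"
    and "lie_algebra.lie_nilpotent scale bracket (lie_algebra.bracket_span scale bracket UNIV UNIV)"
  shows "lie_algebra.ad_stable scale bracket {x} (lie_algebra.env_weight_space scale bracket H \<phi>)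
    \<and> lie_algebra.ad_stable scale bracket UNIV (lie_algebra.env_weight_space scale bracket H \<phi>)"
proof -
  interpret lie_algebra scale bracket by fact
  \<comment> \<open>Stability is obtained for all of L at once; ad x is a special case.\<close>
  have "ad_stable UNIV (env_weight_space H \<phi>)"
    using assms(5,8) by (rule ad_stable_env_weight_space)
  then show ?thesis
    by (simp add: ad_stable_def)
qed

end
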